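(* Let $\delta>0$ be an integer. The degree distribution of the weighted graphs $\mathcal{W}_n$ exhibits a power-law behavior $P_{\rm cum}(k)\sim k^{-(\gamma_k-1)}$ with $\gamma_k=1+\frac{\ln(\delta+4)}{\ln(\delta+2)}$.
   Context: The degree of a vertex is its number of neighbors; the strength of a vertex $i$ in a weighted graph is $s_i=\sum_j w_{ij}$, the sum of the weights of its incident edges. The degree distribution $P(k)$ is the probability that a randomly chosen vertex has degree $k$, and the cumulative degree distribution $P_{\rm cum}(k)=\sum_{k'\ge k}P(k')$ is the probability that a vertex has degree greater than or equal to $k$. A network with $P(k)\sim k^{-\gamma}$ is said to have a power-law degree distribution with exponent $\gamma$; its cumulative degree distribution is then also a power law, $P_{\rm cum}(k)\sim k^{-(\gamma-1)}$. The weighted graphs $\mathcal{W}_n$ ($n\ge 0$) are defined recursively for a fixed integer $\delta>0$. $\mathcal{W}_0$ is a triangle whose three edges have weight $1$. For $n\ge1$, $\mathcal{W}_n$ is obtained from $\mathcal{W}_{n-1}$ as follows: (I) for each vertex $i$ of $\mathcal{W}_{n-1}$, of strength $s_i$ in $\mathcal{W}_{n-1}$ (always an even integer), take $s_i/2$ new disjoint copies of $\mathcal{K}_2$ (two vertices joined by an edge of weight $1$) and join both vertices of each copy to $i$ by edges of weight $1$; (II) increase the weight $w$ of every edge that already belonged to $\mathcal{W}_{n-1}$ by $\delta w$, i.e. multiply it by $1+\delta$. *)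

theory Defs
  imports "HOL-Probability.Probability" "HOL-Library.Landau_Symbols"
begin

section \<open>Weighted graphs\<close>

text \<open>Edges are two-element sets of vertices; \<open>weight\<close> is only meaningful on edges.\<close>

record 'v wgraph =
  verts :: "'v set"
  edges :: "'v set set"
  weight :: "'v set \<Rightarrow> nat"

definition neighbours :: "'v wgraph \<Rightarrow> 'v \<Rightarrow> 'v set" where
  "neighbours G i = {j \<in> verts G. {i, j} \<in> edges G}"

definition vertex_degree :: "'v wgraph \<Rightarrow> 'v \<Rightarrow> nat" where
  "vertex_degree G i = card (neighbours G i)"

definition strength :: "'v wgraph \<Rightarrow> 'v \<Rightarrow> nat" where
  "strength G i = (\<Sum>j\<in>neighbours G i. weight G {i, j})"

definition degree_dist :: "'v wgraph \<Rightarrow> nat \<Rightarrow> real" where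
  "degree_dist G k = pmf (map_pmf (vertex_degree G) (pmf_of_set (verts G))) k"

definition cum_degree_dist :: "'v wgraph \<Rightarrow> nat \<Rightarrow> real" where
  "cum_degree_dist G k = (\<Sum>\<^sub>\<infinity>k'\<in>{k..}. degree_dist G k')"


section \<open>The graphs \<open>W\<^sub>n\<close>\<close>

text \<open>\<open>Child n i c b\<close> is the endpoint \<open>b\<close> of the \<open>c\<close>-th copy of \<open>K\<^sub>2\<close> attached to the vertex
  \<open>i\<close> in the step from \<open>W\<^sub>n\<close> to \<open>W\<^sub>n\<^sub>+\<^sub>1\<close>. As all vertices of \<open>W\<^sub>n\<close> carry smaller step numbers,
  the attached vertices are new.\<close>

datatype vertex = Corner nat | Child nat vertex nat bool

text \<open>The step numbered \<open>n\<close>. The strengths are even, so \<open>div\<close> is exact division here.\<close>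

definition new_verts :: "nat \<Rightarrow> vertex wgraph \<Rightarrow> vertex set" where
  "new_verts n G = {Child n i c b | i c b. i \<in> verts G \<and> c < strength G i div 2}"

definition new_edges :: "nat \<Rightarrow> vertex wgraph \<Rightarrow> vertex set set" where
  "new_edges n G =
     {{Child n i c False, Child n i c True} | i c. i \<in> verts G \<and> c < strength G i div 2} \<union>
     {{i, Child n i c b} | i c b. i \<in> verts G \<and> c < strength G i div 2}"

definition grow :: "nat \<Rightarrow> nat \<Rightarrow> vertex wgraph \<Rightarrow> vertex wgraph" where
  "grow \<delta> n G =
     \<lparr>verts = verts G \<union> new_verts n G,
      edges = edges G \<union> new_edges n G,
      weight = (\<lambda>e. if e \<in> edges G then (1 + \<delta>) * weight G e else 1)\<rparr>"

fun W :: "nat \<Rightarrow> nat \<Rightarrow> vertex wgraph" where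
  "W \<delta> 0 =
     \<lparr>verts = {Corner 0, Corner 1, Corner 2},
      edges = {{Corner 0, Corner 1}, {Corner 1, Corner 2}, {Corner 0, Corner 2}},
      weight = (\<lambda>e. 1)\<rparr>"
| "W \<delta> (Suc n) = grow \<delta> n (W \<delta> n)"


section \<open>Power-law behaviour of the cumulative degree distribution\<close>

definition occurring_degrees :: "(nat \<Rightarrow> 'v wgraph) \<Rightarrow> nat set" where
  "occurring_degrees G = {vertex_degree (G n) v | n v. v \<in> verts (G n)}"

text \<open>
  A sequence of finite graphs has a cumulative degree distribution of the form
  \<open>P\<^sub>c\<^sub>u\<^sub>m(k) \<sim> k\<^sup>-\<^sup>(\<^sup>\<gamma>\<^sup>-\<^sup>1\<^sup>)\<close> in the following sense:

  \<^item> up to constants not depending on the graph, \<open>P\<^sub>c\<^sub>u\<^sub>m(k)\<close> is of size \<open>k\<^sup>-\<^sup>(\<^sup>\<gamma>\<^sup>-\<^sup>1\<^sup>)\<close> over the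
    whole range from \<open>1\<close> to the maximum degree of each graph;

  \<^item> the cumulative degree distributions converge to a limiting one, which is asymptotically
    equivalent to a constant times \<open>k\<^sup>-\<^sup>(\<^sup>\<gamma>\<^sup>-\<^sup>1\<^sup>)\<close> as \<open>k\<close> tends to infinity along the degrees that
    occur. The restriction matters when the degrees are sparse: between two consecutive
    occurring degrees \<open>P\<^sub>c\<^sub>u\<^sub>m\<close> is constant, so if these grow geometrically then
    \<open>P\<^sub>c\<^sub>u\<^sub>m(k) k\<^sup>\<gamma>\<^sup>-\<^sup>1\<close> cannot converge along all integers.
\<close>

definition cum_power_law :: "(nat \<Rightarrow> 'v wgraph) \<Rightarrow> real \<Rightarrow> bool" where
  "cum_power_law G \<gamma> \<longleftrightarrow>
     (\<exists>a>0. \<exists>b>0. \<forall>n. \<forall>v\<in>verts (G n). \<forall>k\<in>{1..vertex_degree (G n) v}.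
        a * real k powr (- (\<gamma> - 1)) \<le> cum_degree_dist (G n) k \<and>
        cum_degree_dist (G n) k \<le> b * real k powr (- (\<gamma> - 1))) \<and>
     infinite (occurring_degrees G) \<and>
     (\<exists>P. (\<forall>k. (\<lambda>n. cum_degree_dist (G n) k) \<longlonglongrightarrow> P k) \<and>
        (\<exists>c>0. P \<sim>[inf at_top (principal (occurring_degrees G))]
           (\<lambda>k. c * real k powr (- (\<gamma> - 1)))))"

end

theory Submission
  imports Defs
begin

text \<open>
  One step multiplies the strength \<open>s\<close> of an old vertex by \<open>\<delta> + 2\<close> and raises its degree by \<open>s\<close>;
  a new vertex has degree and strength \<open>2\<close>. So the degree of a vertex is an increasing function of
  its age alone, of order \<open>(\<delta> + 2)\<^sup>a\<close> at age \<open>a\<close>. The total strength grows by the factor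
  \<open>\<delta> + 4\<close> in each step and equals the number of new vertices, so the order of \<open>W\<^sub>n\<close> is of size
  \<open>(\<delta> + 4)\<^sup>n\<close>. The vertices of degree at least \<open>k\<close> in \<open>W\<^sub>n\<close> are those of a certain age \<open>a\<close> or
  more, that is, the vertices of \<open>W\<^sub>n\<^sub>-\<^sub>a\<close>; their proportion is about \<open>(\<delta> + 4)\<^sup>-\<^sup>a\<close>, while \<open>k\<close> is
  about \<open>(\<delta> + 2)\<^sup>a\<close>.
\<close>

section \<open>Neighbourhoods, degrees and strengths under one growth step\<close>

text \<open>As all edges lie inside \<open>verts G\<close> and no child numbered \<open>n\<close> is
  there yet, old edges never touch a new child and new edges never join two old vertices.\<close>

lemma neighbours_grow_old:
  assumes "\<Union>(edges G) \<subseteq> verts G" and fresh: "\<And>i c b. Child n i c b \<notin> verts G" and "i \<in> verts G"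
  shows "neighbours (grow \<delta> n G) i =
    neighbours G i \<union> (\<lambda>(c, b). Child n i c b) ` ({..<strength G i div 2} \<times> UNIV)"
proof -
  have "\<not> {i, Child n i' c b} \<in> edges G" for i' c b
    using assms by blast
  moreover have "{i, Child n i' c b} \<in> new_edges n G \<longleftrightarrow> i' = i \<and> c < strength G i div 2"
    for i' c b
    using assms(3) fresh by (cases b) (auto simp: new_edges_def doubleton_eq_iff)
  moreover have "{i, j} \<notin> new_edges n G" if "j \<in> verts G" for j
    using that assms(3) fresh by (auto simp: new_edges_def doubleton_eq_iff)
  moreover have "j \<in> verts G \<union> new_verts n G \<longleftrightarrow>
      j \<in> verts G \<or> (\<exists>i'\<in>verts G. \<exists>c<strength G i' div 2. \<exists>b. j = Child n i' c b)" for j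
    by (auto simp: new_verts_def)
  ultimately show ?thesis
    using assms(3) by (auto simp: neighbours_def grow_def image_iff)
qed

lemma neighbours_grow_new:
  assumes "\<Union>(edges G) \<subseteq> verts G" and fresh: "\<And>i c b. Child n i c b \<notin> verts G"
    and "i \<in> verts G" "c < strength G i div 2"
  shows "neighbours (grow \<delta> n G) (Child n i c b) = {i, Child n i c (\<not> b)}"
proof -
  have 1: "\<not> {Child n i c b, j} \<in> edges G" for j
    using assms by blast
  have 2: "{Child n i c b, j} \<in> new_edges n G \<longleftrightarrow> j = i \<or> j = Child n i c (\<not> b)" for j
  proof
    assume "{Child n i c b, j} \<in> new_edges n G"
    thus "j = i \<or> j = Child n i c (\<not> b)"
      using assms(3) fresh by (auto simp: new_edges_def doubleton_eq_iff)
  next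
    have "{i, Child n i c b} \<in> new_edges n G" "{Child n i c False, Child n i c True} \<in> new_edges n G"
      unfolding new_edges_def using assms(3,4) by blast+
    moreover assume "j = i \<or> j = Child n i c (\<not> b)"
    ultimately show "{Child n i c b, j} \<in> new_edges n G"
      \<comment> \<open>Both edges are listed in one order only, so the pairs may have to be
        swapped.\<close>
      by (cases b) (auto simp: insert_commute)
  qed
  show ?thesis
    using assms(3,4) 1 2 by (auto simp: neighbours_def grow_def new_verts_def)
qed

lemma finite_neighbours: "finite (verts G) \<Longrightarrow> finite (neighbours G i)"
  by (simp add: neighbours_def)

text \<open>Stated for arbitrary \<open>f\<close> to serve twice: the constant 1 yields the degree,
  the edge weight yields the strength.\<close>

lemma sum_grow_old:
  fixes f :: "vertex \<Rightarrow> nat"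
  assumes "\<Union>(edges G) \<subseteq> verts G" and fresh: "\<And>i c b. Child n i c b \<notin> verts G" and "i \<in> verts G"
    and "finite (verts G)"
  shows "(\<Sum>j\<in>neighbours (grow \<delta> n G) i. f j) =
    (\<Sum>j\<in>neighbours G i. f j) + (\<Sum>(c, b)\<in>{..<strength G i div 2} \<times> UNIV. f (Child n i c b))"
proof -
  have "inj_on (\<lambda>(c, b). Child n i c b) ({..<strength G i div 2} \<times> UNIV)"
    by (auto simp: inj_on_def)
  moreover have "neighbours G i \<inter> (\<lambda>(c, b). Child n i c b) ` ({..<strength G i div 2} \<times> UNIV) = {}"
    using fresh by (auto simp: neighbours_def)
  ultimately show ?thesis
    using assms by (simp add: neighbours_grow_old sum.union_disjoint finite_neighbours sum.reindex
        case_prod_unfold)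
qed

text \<open>The vertex gets \<open>strength G i div 2\<close> copies with two endpoints each;
  evenness makes this count the strength itself.\<close>

lemma degree_grow_old:
  assumes "\<Union>(edges G) \<subseteq> verts G" "\<And>i c b. Child n i c b \<notin> verts G" "i \<in> verts G"
    and "finite (verts G)" "even (strength G i)"
  shows "vertex_degree (grow \<delta> n G) i = vertex_degree G i + strength G i"
  using sum_grow_old[OF assms(1-4), where f = "\<lambda>_. 1"] assms(5) by (simp add: vertex_degree_def)

lemma strength_grow_old:
  assumes "\<Union>(edges G) \<subseteq> verts G" "\<And>i c b. Child n i c b \<notin> verts G" "i \<in> verts G"
    and "finite (verts G)" "even (strength G i)"
  shows "strength (grow \<delta> n G) i = (\<delta> + 2) * strength G i"
proof -
  \<comment> \<open>Hence edges to children fall into the \<open>else\<close> branch of the weight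
    in \<open>grow\<close> and have weight 1.\<close>
  have "{i, Child n i' c b} \<notin> edges G" for i' c b
    using assms by blast
  hence "strength (grow \<delta> n G) i =
      (\<Sum>j\<in>neighbours G i. weight (grow \<delta> n G) {i, j}) + strength G i"
    using sum_grow_old[OF assms(1-4), where f = "\<lambda>j. weight (grow \<delta> n G) {i, j}"] assms(5)
    by (simp add: strength_def grow_def)
  also have "(\<Sum>j\<in>neighbours G i. weight (grow \<delta> n G) {i, j}) = (1 + \<delta>) * strength G i"
    unfolding strength_def sum_distrib_left
    by (rule sum.cong) (auto simp: neighbours_def grow_def)
  finally show ?thesis by simp
qed

lemma degree_grow_new:
  assumes "\<Union>(edges G) \<subseteq> verts G" and "\<And>i c b. Child n i c b \<notin> verts G"
    and "i \<in> verts G" "c < strength G i div 2"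
  shows "vertex_degree (grow \<delta> n G) (Child n i c b) = 2"
proof -
  have "i \<noteq> Child n i c (\<not> b)" using assms(2,3) by metis
  thus ?thesis using neighbours_grow_new[OF assms, of \<delta> b] by (simp add: vertex_degree_def)
qed

lemma strength_grow_new:
  assumes "\<Union>(edges G) \<subseteq> verts G" and "\<And>i c b. Child n i c b \<notin> verts G"
    and "i \<in> verts G" "c < strength G i div 2"
  shows "strength (grow \<delta> n G) (Child n i c b) = 2"
proof -
  have "i \<noteq> Child n i c (\<not> b)" using assms(2,3) by metis
  moreover have "{Child n i c b, j} \<notin> edges G" for j
    using assms by blast
  ultimately show ?thesis
    using neighbours_grow_new[OF assms, of \<delta> b] by (simp add: strength_def grow_def)
qed

section \<open>Degree and strength of a vertex as functions of its age\<close>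

text \<open>Index of the first graph containing the vertex: step \<open>n\<close> leads to
  \<open>W \<delta> (Suc n)\<close>. The age of \<open>v\<close> in \<open>W \<delta> n\<close> is
  \<open>n - birth v\<close>.\<close>

primrec birth :: "vertex \<Rightarrow> nat" where
  "birth (Corner j) = 0"
| "birth (Child n i c b) = Suc n"

lemma verts_W_Suc: "verts (W \<delta> (Suc n)) = verts (W \<delta> n) \<union> new_verts n (W \<delta> n)"
  by (simp add: grow_def)

lemma birth_le: "v \<in> verts (W \<delta> n) \<Longrightarrow> birth v \<le> n"
  by (induction n) (auto simp: grow_def new_verts_def)

text \<open>Its birth index \<open>Suc n\<close> would exceed \<open>n\<close>. This discharges the
  freshness hypothesis of the growth lemmas.\<close>

lemma Child_notin_verts_W: "Child n i c b \<notin> verts (W \<delta> n)"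
  using birth_le by fastforce

lemma edges_W: "\<Union>(edges (W \<delta> n)) \<subseteq> verts (W \<delta> n)"
  by (induction n) (auto simp: grow_def new_verts_def new_edges_def)

lemma new_verts_eq_image:
  "new_verts n G = (\<lambda>(i, c, b). Child n i c b) ` (SIGMA i:verts G. {..<strength G i div 2} \<times> UNIV)"
  by (auto simp: new_verts_def image_iff)

lemma finite_verts_W: "finite (verts (W \<delta> n))"
  by (induction n) (auto simp: grow_def new_verts_eq_image)

lemma verts_W_nonempty: "verts (W \<delta> n) \<noteq> {}"
  by (induction n) (auto simp: grow_def)

text \<open>Steps only add vertices, and those after \<open>m\<close> add only vertices born later.
  This turns counting vertices by age into the order of an earlier graph.\<close>

lemma verts_W_birth:
  assumes "m \<le> n"
  shows "{v \<in> verts (W \<delta> n). birth v \<le> m} = verts (W \<delta> m)"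
  using assms
proof (induction n rule: dec_induct)
  case base
  show ?case using birth_le by blast
next
  case (step n)
  hence "{v \<in> new_verts n (W \<delta> n). birth v \<le> m} = {}"
    by (auto simp: new_verts_def)
  hence "{v \<in> verts (W \<delta> (Suc n)). birth v \<le> m} = {v \<in> verts (W \<delta> n). birth v \<le> m}"
    unfolding verts_W_Suc by blast
  thus ?case using step.IH by simp
qed

text \<open>The initial degree 2 plus the strengths at all earlier ages, each of which was added to
  the degree.\<close>

definition aged_degree :: "nat \<Rightarrow> nat \<Rightarrow> nat" where
  "aged_degree \<delta> a = 2 + (\<Sum>j<a. 2 * (\<delta> + 2) ^ j)"

lemma neighbours_W_0:
  "v \<in> verts (W \<delta> 0) \<Longrightarrow> neighbours (W \<delta> 0) v = verts (W \<delta> 0) - {v}"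
  by (auto simp: neighbours_def doubleton_eq_iff)

text \<open>Both claims share one induction: the degree grows by the strength, and the strength
  formula supplies the evenness that the growth lemmas require.\<close>

lemma strength_degree_W:
  assumes "v \<in> verts (W \<delta> n)"
  shows "strength (W \<delta> n) v = 2 * (\<delta> + 2) ^ (n - birth v) \<and>
    vertex_degree (W \<delta> n) v = aged_degree \<delta> (n - birth v)"
  using assms
proof (induction n)
  case 0
  have "card (verts (W \<delta> 0) - {v}) = 2"
    using 0 by (subst card_Diff_singleton) simp_all
  moreover have "weight (W \<delta> 0) e = 1" for e
    by simp
  ultimately show ?case
    unfolding strength_def vertex_degree_def neighbours_W_0[OF 0]
    by (simp add: aged_degree_def del: W.simps)
next
  case (Suc n)
  note grow = edges_W[of \<delta> n] Child_notin_verts_W[of n _ _ _ \<delta>]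
  consider "v \<in> verts (W \<delta> n)" | "v \<in> new_verts n (W \<delta> n)"
    using Suc.prems by (auto simp: grow_def)
  thus ?case
  proof cases
    case 1
    from Suc.IH[OF 1] have
      IH: "strength (W \<delta> n) v = 2 * (\<delta> + 2) ^ (n - birth v)"
        "vertex_degree (W \<delta> n) v = aged_degree \<delta> (n - birth v)"
      by auto
    have "even (strength (W \<delta> n) v)" using IH by simp
    thus ?thesis
      using strength_grow_old[OF grow 1 finite_verts_W] degree_grow_old[OF grow 1 finite_verts_W]
        birth_le[OF 1]
      by (simp add: IH aged_degree_def Suc_diff_le)
  next
    case 2
    then obtain i c b where "v = Child n i c b" "i \<in> verts (W \<delta> n)" "c < strength (W \<delta> n) i div 2"
      by (auto simp: new_verts_def)
    thus ?thesis
      using strength_grow_new[OF grow] degree_grow_new[OF grow] by (simp add: aged_degree_def)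
  qed
qed

section \<open>Total strength and order of \<open>W \<delta> n\<close>\<close>

lemma even_strength_W: "v \<in> verts (W \<delta> n) \<Longrightarrow> even (strength (W \<delta> n) v)"
  by (simp add: strength_degree_W)

lemma verts_new_verts_disjoint: "verts (W \<delta> n) \<inter> new_verts n (W \<delta> n) = {}"
  using Child_notin_verts_W by (auto simp: new_verts_def)

lemma finite_new_verts_W: "finite (new_verts n (W \<delta> n))"
  using finite_verts_W[of \<delta> "Suc n"] by (simp add: verts_W_Suc del: W.simps)

lemma card_new_verts_W:
  "card (new_verts n (W \<delta> n)) = (\<Sum>v\<in>verts (W \<delta> n). strength (W \<delta> n) v)"
proof -
  have "inj_on (\<lambda>(i, c, b). Child n i c b)
      (SIGMA i:verts (W \<delta> n). {..<strength (W \<delta> n) i div 2} \<times> UNIV)"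
    by (auto simp: inj_on_def)
  hence "card (new_verts n (W \<delta> n)) = (\<Sum>i\<in>verts (W \<delta> n). strength (W \<delta> n) i div 2 * 2)"
    by (simp add: new_verts_eq_image card_image card_SigmaI finite_verts_W card_cartesian_product)
  thus ?thesis by (simp add: even_strength_W)
qed

text \<open>If the total is \<open>S\<close>, the old vertices then carry
  \<open>(\<delta> + 2) * S\<close> and the \<open>S\<close> new ones 2 each, which gives the factor
  \<open>\<delta> + 4\<close>.\<close>

lemma total_strength_W: "(\<Sum>v\<in>verts (W \<delta> n). strength (W \<delta> n) v) = 6 * (\<delta> + 4) ^ n"
proof (induction n)
  case 0
  have "(\<Sum>v\<in>verts (W \<delta> 0). strength (W \<delta> 0) v) = (\<Sum>v\<in>verts (W \<delta> 0). 2)"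
    by (rule sum.cong) (simp_all add: strength_degree_W del: W.simps)
  thus ?case by simp
next
  case (Suc n)
  have "(\<Sum>v\<in>verts (W \<delta> (Suc n)). strength (W \<delta> (Suc n)) v) =
      (\<Sum>v\<in>verts (W \<delta> n). strength (W \<delta> (Suc n)) v) +
      (\<Sum>v\<in>new_verts n (W \<delta> n). strength (W \<delta> (Suc n)) v)"
    unfolding verts_W_Suc
    by (rule sum.union_disjoint) (simp_all add: finite_verts_W finite_new_verts_W
        verts_new_verts_disjoint)
  also have "(\<Sum>v\<in>verts (W \<delta> n). strength (W \<delta> (Suc n)) v) =
      (\<Sum>v\<in>verts (W \<delta> n). (\<delta> + 2) * strength (W \<delta> n) v)"
    by (intro sum.cong) (simp_all add: strength_grow_old edges_W Child_notin_verts_W finite_verts_W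
        even_strength_W)
  also have "(\<Sum>v\<in>new_verts n (W \<delta> n). strength (W \<delta> (Suc n)) v) =
      (\<Sum>v\<in>new_verts n (W \<delta> n). 2)"
    by (intro sum.cong) (auto simp: new_verts_def strength_grow_new edges_W Child_notin_verts_W)
  finally show ?case
    unfolding sum_distrib_left[symmetric]
    by (simp only: Suc.IH sum_constant card_new_verts_W) (simp add: algebra_simps)
qed

text \<open>A geometric sum of the numbers of new vertices; the factor \<open>\<delta> + 3\<close>
  clears its denominator, so that the identity lives in the naturals.\<close>

lemma card_verts_W: "(\<delta> + 3) * card (verts (W \<delta> n)) = 3 * (\<delta> + 1) + 6 * (\<delta> + 4) ^ n"
proof (induction n)
  case 0
  show ?case by simp
next
  case (Suc n)
  have "card (verts (W \<delta> (Suc n))) = card (verts (W \<delta> n)) + 6 * (\<delta> + 4) ^ n"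
    unfolding verts_W_Suc
    by (simp add: card_Un_disjoint finite_verts_W finite_new_verts_W verts_new_verts_disjoint
        card_new_verts_W total_strength_W)
  thus ?case using Suc by (simp add: algebra_simps)
qed

section \<open>From degrees to ages: the cumulative distribution\<close>

lemma strict_mono_aged_degree: "strict_mono (aged_degree \<delta>)"
  by (rule strict_mono_Suc_iff[THEN iffD2]) (simp add: aged_degree_def)

definition age_of :: "nat \<Rightarrow> nat \<Rightarrow> nat" where
  "age_of \<delta> k = (LEAST a. k \<le> aged_degree \<delta> a)"

text \<open>A Galois connection, which lets a lower bound on the degree be read as a lower bound on
  the age.\<close>

lemma age_of_le_iff: "age_of \<delta> k \<le> a \<longleftrightarrow> k \<le> aged_degree \<delta> a"
proof
  \<comment> \<open>A witness that the set under \<open>LEAST\<close> is nonempty.\<close>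
  have "k \<le> aged_degree \<delta> k"
    using strict_mono_aged_degree by (rule strict_mono_imp_increasing)
  hence "k \<le> aged_degree \<delta> (age_of \<delta> k)"
    unfolding age_of_def by (rule LeastI)
  also assume "age_of \<delta> k \<le> a"
  hence "aged_degree \<delta> (age_of \<delta> k) \<le> aged_degree \<delta> a"
    using strict_mono_aged_degree by (simp add: strict_mono_less_eq)
  finally show "k \<le> aged_degree \<delta> a" .
next
  assume "k \<le> aged_degree \<delta> a"
  thus "age_of \<delta> k \<le> a"
    unfolding age_of_def by (rule Least_le)
qed

lemma age_of_aged_degree: "age_of \<delta> (aged_degree \<delta> a) = a"
  unfolding age_of_def
  by (rule Least_equality) (simp_all add: strict_mono_aged_degree[THEN strict_mono_less_eq])

lemma cum_degree_dist_eq_card: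
  assumes "finite (verts G)" "verts G \<noteq> {}"
  shows "cum_degree_dist G k = card {v \<in> verts G. k \<le> vertex_degree G v} / card (verts G)"
proof -
  let ?M = "map_pmf (vertex_degree G) (pmf_of_set (verts G))"
  \<comment> \<open>Absolute summability of the pmf identifies the two infinite sums; the second one
    is a probability.\<close>
  have "cum_degree_dist G k = infsetsum (pmf ?M) {k..}"
    unfolding cum_degree_dist_def degree_dist_def
    by (rule infsetsum_infsum[symmetric]) (rule pmf_abs_summable)
  also have "\<dots> = measure_pmf.prob ?M {k..}"
    by (simp add: measure_pmf_conv_infsetsum)
  also have "\<dots> = card (verts G \<inter> {v. k \<le> vertex_degree G v}) / card (verts G)"
    using assms by (simp add: measure_map_pmf measure_pmf_of_set vimage_def)
  also have "verts G \<inter> {v. k \<le> vertex_degree G v} = {v \<in> verts G. k \<le> vertex_degree G v}"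
    by auto
  finally show ?thesis .
qed

text \<open>Degree at least \<open>k\<close> means age at least \<open>age_of \<delta> k\<close>.
  The hypothesis keeps the subtraction from being truncated.\<close>

lemma cum_degree_dist_W:
  assumes "age_of \<delta> k \<le> n"
  shows "cum_degree_dist (W \<delta> n) k =
    card (verts (W \<delta> (n - age_of \<delta> k))) / card (verts (W \<delta> n))"
proof -
  have "{v \<in> verts (W \<delta> n). k \<le> vertex_degree (W \<delta> n) v} =
      {v \<in> verts (W \<delta> n). birth v \<le> n - age_of \<delta> k}"
    using assms birth_le
    by (force simp: strength_degree_W age_of_le_iff[symmetric])
  also have "\<dots> = verts (W \<delta> (n - age_of \<delta> k))"
    by (rule verts_W_birth) simp
  finally show ?thesis
    by (simp add: cum_degree_dist_eq_card finite_verts_W verts_W_nonempty)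
qed

section \<open>Explicit estimates for degrees, ages and orders\<close>

lemma aged_degree_closed: "real (aged_degree \<delta> a) = 2 * (real \<delta> + (real \<delta> + 2) ^ a) / (real \<delta> + 1)"
proof -
  have "real (aged_degree \<delta> a) * (real \<delta> + 1) = 2 * (real \<delta> + (real \<delta> + 2) ^ a)"
    by (induction a) (simp_all add: aged_degree_def algebra_simps)
  thus ?thesis by (simp add: field_simps)
qed

lemma aged_degree_upper: "real (aged_degree \<delta> a) \<le> 2 * (real \<delta> + 2) ^ a"
proof -
  have "1 \<le> (real \<delta> + 2) ^ a" by (simp add: one_le_power)
  hence "real \<delta> * 1 \<le> real \<delta> * (real \<delta> + 2) ^ a" by (intro mult_left_mono) auto
  thus ?thesis by (simp add: aged_degree_closed field_simps)
qed

text \<open>One factor \<open>\<delta> + 2\<close> pays for passing to the preceding age, whose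
  degree is below \<open>k\<close>; the other compares the power with that degree.\<close>

lemma age_of_upper:
  assumes "1 \<le> k"
  shows "(real \<delta> + 2) ^ age_of \<delta> k \<le> (real \<delta> + 2) ^ 2 * real k"
proof (cases "age_of \<delta> k")
  case 0
  have "1 * 1 \<le> (real \<delta> + 2) ^ 2 * real k"
    using assms by (intro mult_mono one_le_power) auto
  with 0 show ?thesis by simp
next
  case (Suc a)
  hence "aged_degree \<delta> a < k"
    using age_of_le_iff[of \<delta> k a] by simp
  have "(real \<delta> + 2) ^ a \<le> (real \<delta> + 2) * real (aged_degree \<delta> a)"
    by (simp add: aged_degree_closed field_simps add_pos_nonneg)
  also have "\<dots> \<le> (real \<delta> + 2) * real k"
    using \<open>aged_degree \<delta> a < k\<close> by (intro mult_left_mono) auto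
  finally have "(real \<delta> + 2) * (real \<delta> + 2) ^ a \<le> (real \<delta> + 2) * ((real \<delta> + 2) * real k)"
    by (intro mult_left_mono) auto
  thus ?thesis by (simp add: Suc power2_eq_square mult.assoc)
qed

text \<open>The source of the exponent: it converts powers of \<open>\<delta> + 2\<close> (degrees)
  into powers of \<open>\<delta> + 4\<close> (orders).\<close>

lemma power_powr_ln_quotient:
  fixes q r :: real
  assumes "1 < r" "0 < q"
  shows "(r ^ a) powr (ln q / ln r) = q ^ a"
  using assms by (simp add: powr_def ln_realpow exp_of_nat2_mult)

lemma card_verts_W_bounds:
  shows "6 * (real \<delta> + 4) ^ n \<le> (real \<delta> + 3) * card (verts (W \<delta> n))"
    and "card (verts (W \<delta> n)) \<le> 3 * (real \<delta> + 4) ^ n"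
proof -
  have eq: "(real \<delta> + 3) * card (verts (W \<delta> n)) = 3 * (real \<delta> + 1) + 6 * (real \<delta> + 4) ^ n"
    using arg_cong[OF card_verts_W[of \<delta> n], of real] by simp
  thus "6 * (real \<delta> + 4) ^ n \<le> (real \<delta> + 3) * card (verts (W \<delta> n))"
    by simp
  \<comment> \<open>Absorbs the constant term into the power; the total coefficient
    \<open>3 * (\<delta> + 1) + 6\<close> is \<open>3 * (\<delta> + 3)\<close>.\<close>
  have "3 * (real \<delta> + 1) * 1 \<le> 3 * (real \<delta> + 1) * (real \<delta> + 4) ^ n"
    by (intro mult_left_mono one_le_power) auto
  with eq have "(real \<delta> + 3) * card (verts (W \<delta> n)) \<le> (real \<delta> + 3) * (3 * (real \<delta> + 4) ^ n)"
    by (simp add: algebra_simps)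
  thus "card (verts (W \<delta> n)) \<le> 3 * (real \<delta> + 4) ^ n"
    by (rule mult_left_le_imp_le) simp
qed

text \<open>Opposite bounds on numerator and denominator are paired: the constants are the quotients
  of \<open>6 / (\<delta> + 3)\<close> and 3, taken both ways.\<close>

lemma card_verts_W_ratio_bounds:
  assumes "a \<le> n"
  shows "2 / ((real \<delta> + 3) * (real \<delta> + 4) ^ a) \<le> card (verts (W \<delta> (n - a))) / card (verts (W \<delta> n))"
    and "card (verts (W \<delta> (n - a))) / card (verts (W \<delta> n)) \<le> (real \<delta> + 3) / (2 * (real \<delta> + 4) ^ a)"
proof -
  let ?N = "\<lambda>n. real (card (verts (W \<delta> n)))" and ?q = "real \<delta> + 4"
  have pos: "?N m > 0" for m
    by (simp add: card_gt_0_iff finite_verts_W verts_W_nonempty)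
  have cross: "w / x \<le> y / z" if "w * z \<le> y * x" "0 < x" "0 < z" for w x y z :: real
    using that by (simp add: field_simps)
  have split: "?q ^ n = ?q ^ (n - a) * ?q ^ a"
    using assms by (simp flip: power_add)
  have "2 * ?N n \<le> 6 * ?q ^ (n - a) * ?q ^ a"
    using card_verts_W_bounds(2)[of \<delta> n] by (simp only: split mult.assoc)
  also have "\<dots> \<le> (real \<delta> + 3) * ?N (n - a) * ?q ^ a"
    by (intro mult_right_mono card_verts_W_bounds) auto
  also have "\<dots> = ?N (n - a) * ((real \<delta> + 3) * ?q ^ a)"
    by (simp only: mult_ac)
  finally show "2 / ((real \<delta> + 3) * ?q ^ a) \<le> ?N (n - a) / ?N n"
    by (rule cross) (use pos in auto)
  have "?N (n - a) * (2 * ?q ^ a) \<le> 3 * ?q ^ (n - a) * (2 * ?q ^ a)"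
    by (intro mult_right_mono card_verts_W_bounds) auto
  also have "\<dots> \<le> (real \<delta> + 3) * ?N n"
    using card_verts_W_bounds(1)[of \<delta> n] by (simp add: split)
  finally show "?N (n - a) / ?N n \<le> (real \<delta> + 3) / (2 * ?q ^ a)"
    by (rule cross) (use pos in auto)
qed

section \<open>The limiting distribution and its asymptotics\<close>

text \<open>Scaled by their powers of \<open>\<delta> + 4\<close>, both orders have the same nonzero
  limit, so only the offset \<open>a\<close> survives.\<close>

lemma card_verts_W_ratio_tendsto:
  "(\<lambda>n. card (verts (W \<delta> (n - a))) / card (verts (W \<delta> n))) \<longlonglongrightarrow> 1 / (real \<delta> + 4) ^ a"
\<comment> \<open>The shift by \<open>a\<close> removes the truncated subtraction
  \<open>n - a\<close>.\<close>
proof (rule LIMSEQ_offset[of _ a])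
  let ?N = "\<lambda>n. real (card (verts (W \<delta> n)))" and ?q = "real \<delta> + 4"
  have N: "?N n / ?q ^ n = 3 * (real \<delta> + 1) / (real \<delta> + 3) * (1 / ?q) ^ n + 6 / (real \<delta> + 3)" for n
  proof -
    have "(real \<delta> + 3) * ?N n = 3 * (real \<delta> + 1) + 6 * ?q ^ n"
      using arg_cong[OF card_verts_W[of \<delta> n], of real] by simp
    moreover have "y / z = w / x * (1 / z) + 6 / x" if "x * y = w + 6 * z" "0 < x" "0 < z"
      for w x y z :: real
      using that by (simp add: field_simps)
    ultimately show ?thesis by (simp add: power_one_over)
  qed
  have "(\<lambda>n. 3 * (real \<delta> + 1) / (real \<delta> + 3) * (1 / ?q) ^ n + 6 / (real \<delta> + 3)) \<longlonglongrightarrow>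
      3 * (real \<delta> + 1) / (real \<delta> + 3) * 0 + 6 / (real \<delta> + 3)"
    by (intro tendsto_intros LIMSEQ_power_zero) auto
  hence lim: "(\<lambda>n. ?N n / ?q ^ n) \<longlonglongrightarrow> 6 / (real \<delta> + 3)"
    by (simp add: N)
  have "(\<lambda>n. (?N n / ?q ^ n) / (?N (n + a) / ?q ^ (n + a)) / ?q ^ a) \<longlonglongrightarrow>
      (6 / (real \<delta> + 3)) / (6 / (real \<delta> + 3)) / ?q ^ a"
    by (intro tendsto_divide[OF tendsto_divide[OF lim LIMSEQ_ignore_initial_segment[OF lim]]]
        tendsto_const) auto
  thus "(\<lambda>n. ?N (n + a - a) / ?N (n + a)) \<longlonglongrightarrow> 1 / ?q ^ a"
    by (simp add: power_add)
qed

lemma cum_degree_dist_W_tendsto: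
  "(\<lambda>n. cum_degree_dist (W \<delta> n) k) \<longlonglongrightarrow> 1 / (real \<delta> + 4) ^ age_of \<delta> k"
proof (rule Lim_transform_eventually)
  show "(\<lambda>n. card (verts (W \<delta> (n - age_of \<delta> k))) / card (verts (W \<delta> n))) \<longlonglongrightarrow>
      1 / (real \<delta> + 4) ^ age_of \<delta> k"
    by (rule card_verts_W_ratio_tendsto)
  show "\<forall>\<^sub>F n in sequentially. card (verts (W \<delta> (n - age_of \<delta> k))) / card (verts (W \<delta> n)) =
      cum_degree_dist (W \<delta> n) k"
    using eventually_ge_at_top[of "age_of \<delta> k"] by eventually_elim (simp add: cum_degree_dist_W)
qed

text \<open>Every age is realised, since \<open>Corner 0\<close> has age \<open>a\<close> in
  \<open>W \<delta> a\<close>.\<close>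

lemma occurring_degrees_W: "occurring_degrees (W \<delta>) = range (aged_degree \<delta>)"
proof -
  have "Corner 0 \<in> verts (W \<delta> a)" for a
    by (induction a) (auto simp: grow_def)
  hence "\<exists>n v. aged_degree \<delta> a = vertex_degree (W \<delta> n) v \<and> v \<in> verts (W \<delta> n)" for a
    by (intro exI[of _ a] exI[of _ "Corner 0"]) (simp add: strength_degree_W)
  thus ?thesis
    unfolding occurring_degrees_def using strength_degree_W by blast
qed

lemma aged_degree_powr_tendsto:
  fixes \<delta> :: nat
  defines "\<beta> \<equiv> ln (real \<delta> + 4) / ln (real \<delta> + 2)"
  shows "(\<lambda>a. real (aged_degree \<delta> a) powr \<beta> / (real \<delta> + 4) ^ a) \<longlonglongrightarrow> (2 / (real \<delta> + 1)) powr \<beta>"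
proof -
  let ?r = "real \<delta> + 2"
  have "(\<lambda>a. 2 / (real \<delta> + 1) * (real \<delta> * (1 / ?r) ^ a + 1)) \<longlonglongrightarrow>
      2 / (real \<delta> + 1) * (real \<delta> * 0 + 1)"
    by (intro tendsto_intros LIMSEQ_power_zero) auto
  moreover have "real (aged_degree \<delta> a) / ?r ^ a = 2 / (real \<delta> + 1) * (real \<delta> * (1 / ?r) ^ a + 1)" for a
    by (simp add: aged_degree_closed field_simps)
  ultimately have "(\<lambda>a. real (aged_degree \<delta> a) / ?r ^ a) \<longlonglongrightarrow> 2 / (real \<delta> + 1)"
    by simp
  hence "(\<lambda>a. (real (aged_degree \<delta> a) / ?r ^ a) powr \<beta>) \<longlonglongrightarrow> (2 / (real \<delta> + 1)) powr \<beta>"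
    by (rule tendsto_powr) auto
  thus ?thesis
    by (simp add: powr_divide power_powr_ln_quotient \<beta>_def)
qed

text \<open>Along the occurring degrees the quotient is the sequence of
  \<open>aged_degree_powr_tendsto\<close> evaluated at \<open>age_of \<delta> k\<close>, which tends
  to infinity.\<close>

lemma limit_asymp_equiv:
  fixes \<delta> :: nat
  defines "\<beta> \<equiv> ln (real \<delta> + 4) / ln (real \<delta> + 2)"
  shows "(\<lambda>k. 1 / (real \<delta> + 4) ^ age_of \<delta> k)
    \<sim>[inf at_top (principal (occurring_degrees (W \<delta>)))]
    (\<lambda>k. (2 / (real \<delta> + 1)) powr \<beta> * real k powr (- \<beta>))"
proof (rule asymp_equivI'_const)
  let ?F = "inf at_top (principal (occurring_degrees (W \<delta>)))"
  have "filterlim (age_of \<delta>) at_top at_top"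
    unfolding filterlim_at_top
  proof
    fix a
    show "\<forall>\<^sub>F k in at_top. a \<le> age_of \<delta> k"
      using eventually_gt_at_top[of "aged_degree \<delta> a"]
      by eventually_elim (metis age_of_le_iff linorder_not_le nat_le_linear)
  qed
  hence "filterlim (age_of \<delta>) at_top ?F"
    by (rule filterlim_mono) auto
  with aged_degree_powr_tendsto[of \<delta>]
  have "((\<lambda>k. real (aged_degree \<delta> (age_of \<delta> k)) powr \<beta> / (real \<delta> + 4) ^ age_of \<delta> k) \<longlongrightarrow>
      (2 / (real \<delta> + 1)) powr \<beta>) ?F"
    unfolding \<beta>_def by (rule filterlim_compose)
  \<comment> \<open>The restricted filter enters here: an occurring degree is recovered exactly from
    its age.\<close>
  moreover have "\<forall>\<^sub>F k in ?F. real (aged_degree \<delta> (age_of \<delta> k)) powr \<beta> / (real \<delta> + 4) ^ age_of \<delta> k =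
      1 / (real \<delta> + 4) ^ age_of \<delta> k / real k powr (- \<beta>)"
    unfolding eventually_inf_principal occurring_degrees_W
    by (intro always_eventually) (auto simp: age_of_aged_degree powr_minus field_simps)
  ultimately show "((\<lambda>k. 1 / (real \<delta> + 4) ^ age_of \<delta> k / real k powr (- \<beta>)) \<longlongrightarrow>
      (2 / (real \<delta> + 1)) powr \<beta>) ?F"
    by (rule Lim_transform_eventually)
qed simp

section \<open>Bounds uniform in \<open>n\<close>, and the power law\<close>

lemma age_of_power_bounds:
  fixes \<delta> :: nat
  defines "\<beta> \<equiv> ln (real \<delta> + 4) / ln (real \<delta> + 2)"
  assumes "1 \<le> k"
  shows "real k powr \<beta> \<le> 2 powr \<beta> * (real \<delta> + 4) ^ age_of \<delta> k"
    and "(real \<delta> + 4) ^ age_of \<delta> k \<le> (real \<delta> + 4) ^ 2 * real k powr \<beta>"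
proof -
  have \<beta>: "0 \<le> \<beta>" by (simp add: \<beta>_def)
  have pow: "((real \<delta> + 2) ^ a) powr \<beta> = (real \<delta> + 4) ^ a" for a
    by (simp add: \<beta>_def power_powr_ln_quotient)
  have "real k \<le> 2 * (real \<delta> + 2) ^ age_of \<delta> k"
    using age_of_le_iff[of \<delta> k "age_of \<delta> k"] aged_degree_upper[of \<delta> "age_of \<delta> k"] by linarith
  hence "real k powr \<beta> \<le> (2 * (real \<delta> + 2) ^ age_of \<delta> k) powr \<beta>"
    using \<beta> by (intro powr_mono2) auto
  thus "real k powr \<beta> \<le> 2 powr \<beta> * (real \<delta> + 4) ^ age_of \<delta> k"
    by (simp add: powr_mult pow)
  have "((real \<delta> + 2) ^ age_of \<delta> k) powr \<beta> \<le> ((real \<delta> + 2) ^ 2 * real k) powr \<beta>"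
    using \<beta> age_of_upper[OF assms(2), of \<delta>] by (intro powr_mono2) auto
  thus "(real \<delta> + 4) ^ age_of \<delta> k \<le> (real \<delta> + 4) ^ 2 * real k powr \<beta>"
    by (simp add: powr_mult pow)
qed

lemma cum_degree_dist_W_bounds:
  fixes \<delta> :: nat
  defines "\<beta> \<equiv> ln (real \<delta> + 4) / ln (real \<delta> + 2)"
  assumes "v \<in> verts (W \<delta> n)" "1 \<le> k" "k \<le> vertex_degree (W \<delta> n) v"
  shows "2 / ((real \<delta> + 3) * (real \<delta> + 4) ^ 2) * real k powr (- \<beta>) \<le> cum_degree_dist (W \<delta> n) k"
    and "cum_degree_dist (W \<delta> n) k \<le> (real \<delta> + 3) / 2 * 2 powr \<beta> * real k powr (- \<beta>)"
proof -
  let ?q = "real \<delta> + 4" and ?a = "age_of \<delta> k"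
  have k: "k > 0" using assms(3) by simp
  \<comment> \<open>The vertex \<open>v\<close> of degree at least \<open>k\<close> ensures that
    this age has been reached by step \<open>n\<close>.\<close>
  have "?a \<le> n - birth v"
    using assms(2,4) by (simp add: age_of_le_iff strength_degree_W)
  hence a: "?a \<le> n" by simp
  have "2 / ((real \<delta> + 3) * ?q ^ 2) * real k powr (- \<beta>) =
      2 / ((real \<delta> + 3) * (?q ^ 2 * real k powr \<beta>))"
    by (simp add: powr_minus field_simps)
  also have "\<dots> \<le> 2 / ((real \<delta> + 3) * ?q ^ ?a)"
    using age_of_power_bounds(2)[OF assms(3), of \<delta>] k
    by (intro divide_left_mono mult_left_mono mult_pos_pos) (auto simp: \<beta>_def)
  also have "\<dots> \<le> cum_degree_dist (W \<delta> n) k"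
    using card_verts_W_ratio_bounds(1)[OF a] a by (simp add: cum_degree_dist_W)
  finally show "2 / ((real \<delta> + 3) * ?q ^ 2) * real k powr (- \<beta>) \<le> cum_degree_dist (W \<delta> n) k" .
  have "cum_degree_dist (W \<delta> n) k \<le> (real \<delta> + 3) / 2 * (1 / ?q ^ ?a)"
    using card_verts_W_ratio_bounds(2)[OF a, of \<delta>] a by (simp add: cum_degree_dist_W)
  also have "\<dots> \<le> (real \<delta> + 3) / 2 * (2 powr \<beta> * real k powr (- \<beta>))"
    using age_of_power_bounds(1)[OF assms(3), of \<delta>] k
    by (intro mult_left_mono) (auto simp: \<beta>_def powr_minus field_simps)
  finally show "cum_degree_dist (W \<delta> n) k \<le> (real \<delta> + 3) / 2 * 2 powr \<beta> * real k powr (- \<beta>)"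
    by simp
qed

theorem proposition3p2:
  fixes \<delta> :: nat
  assumes "\<delta> > 0"
  shows "cum_power_law (W \<delta>) (1 + ln (real \<delta> + 4) / ln (real \<delta> + 2))"
  unfolding cum_power_law_def
proof (intro conjI)
  \<comment> \<open>The uncancelled \<open>1 + ... - 1\<close> matches the unfolded definition
    literally.\<close>
  let ?\<beta> = "1 + ln (real \<delta> + 4) / ln (real \<delta> + 2) - 1"
  show "\<exists>a>0. \<exists>b>0. \<forall>n. \<forall>v\<in>verts (W \<delta> n). \<forall>k\<in>{1..vertex_degree (W \<delta> n) v}.
      a * real k powr (- ?\<beta>) \<le> cum_degree_dist (W \<delta> n) k \<and>
      cum_degree_dist (W \<delta> n) k \<le> b * real k powr (- ?\<beta>)"
  \<comment> \<open>The witnesses \<open>a\<close> and \<open>b\<close> remain schematic and are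
    fixed by the bounds shown below.\<close>
  proof (intro exI conjI allI ballI)
    fix n v k assume "v \<in> verts (W \<delta> n)" "k \<in> {1..vertex_degree (W \<delta> n) v}"
    thus "2 / ((real \<delta> + 3) * (real \<delta> + 4) ^ 2) * real k powr (- ?\<beta>) \<le> cum_degree_dist (W \<delta> n) k"
      and "cum_degree_dist (W \<delta> n) k \<le> (real \<delta> + 3) / 2 *
        2 powr (ln (real \<delta> + 4) / ln (real \<delta> + 2)) * real k powr (- ?\<beta>)"
      using cum_degree_dist_W_bounds[of v \<delta> n k] by auto
  qed auto
  show "infinite (occurring_degrees (W \<delta>))"
    using strict_mono_aged_degree[THEN strict_mono_imp_inj_on]
    by (simp add: occurring_degrees_W range_inj_infinite)
  show "\<exists>P. (\<forall>k. (\<lambda>n. cum_degree_dist (W \<delta> n) k) \<longlonglongrightarrow> P k) \<and>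
      (\<exists>c>0. P \<sim>[inf at_top (principal (occurring_degrees (W \<delta>)))] (\<lambda>k. c * real k powr (- ?\<beta>)))"
  proof (intro exI conjI allI)
    show "(\<lambda>n. cum_degree_dist (W \<delta> n) k) \<longlonglongrightarrow> 1 / (real \<delta> + 4) ^ age_of \<delta> k" for k
      by (rule cum_degree_dist_W_tendsto)
    show "(\<lambda>k. 1 / (real \<delta> + 4) ^ age_of \<delta> k)
        \<sim>[inf at_top (principal (occurring_degrees (W \<delta>)))]
        (\<lambda>k. (2 / (real \<delta> + 1)) powr (ln (real \<delta> + 4) / ln (real \<delta> + 2)) * real k powr (- ?\<beta>))"
      using limit_asymp_equiv[of \<delta>] by simp
  qed simp
qed

end
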